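(* Let $0 < r$ and $R < \infty$. There exists a constant $C = C(r,R)$ such that the following holds. Let $A, Q$ be periodic sets in $\mathbb{R}^3$, both with packing radius at least $r$ and with covering radius at most $R$. If $d_B(A,Q) < r$, then $$d_\infty(\Psi(A), \Psi(Q)) \leq C \cdot d_B(A,Q).$$
   Context: A basis is a triple $v_1,v_2,v_3$ of linearly independent vectors in $\mathbb{R}^3$. It defines the lattice $\Lambda = \{n_1v_1+n_2v_2+n_3v_3 \mid n_i \in \mathbb{Z}\}$ and the unit cell $U = \{r_1v_1+r_2v_2+r_3v_3 \mid 0 \leq r_i < 1\}$. A motif is a finite nonempty set $M \subseteq U$, and a periodic set is a set of the form $A = M + \Lambda = \{x+v \mid x \in M, v \in \Lambda\}$. The packing radius of $A$ is the largest $r$ such that every open ball of radius $r$ contains at most one point of $A$; the covering radius is the smallest $R$ such that every closed ball of radius $R$ contains at least one point of $A$. For $t \geq 0$ let $B(a;t)$ be the closed ball of radius $t$ centered at $a$. For an integer $k \geq 0$, $\varphi_k^A(t)$ is the volume of the set of points $x \in U$ that belong to $B(a;t)$ for $k$ or more points $a \in A$, divided by $\mathrm{Vol}[U]$. The $k$-th density function is $\psi_k^A \colon [0,\infty) \to [0,1]$, $\psi_k^A(t) = \varphi_k^A(t) - \varphi_{k+1}^A(t)$, i.e. the probability that a uniformly random point of $U$ lies in exactly $k$ of the balls $B(a;t)$, $a \in A$. (This does not depend on the choice of lattice, basis, and motif representing $A$.) The density fingerprint of $A$ is the sequence $\Psi(A) = (\psi_0^A, \psi_1^A, \ldots)$.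 Distances: $d_B(A,Q) = \inf_{\gamma} \sup_{a \in A} \|a - \gamma(a)\|_2$, the infimum being over all bijections $\gamma \colon A \to Q$, and $d_\infty(\Psi(A),\Psi(Q)) = \sup_{k \geq 0} (k+1)^{-2/3}\, \|\psi_k^A - \psi_k^Q\|_\infty$, where $\|\cdot\|_\infty$ is the supremum norm on $[0,\infty)$. *)

theory Defs
  imports "HOL-Analysis.Analysis"
begin

type_synonym R3 = "real^3"

text \<open>A basis is an ordered triple, given as a function on the three-element type \<open>3\<close>. Injectivity is
  needed because \<^const>\<open>independent\<close> only sees the set of the three vectors.\<close>

definition basis3 :: "(3 \<Rightarrow> R3) \<Rightarrow> bool" where
  "basis3 v \<longleftrightarrow> inj v \<and> independent (range v)"

definition lattice_of :: "(3 \<Rightarrow> R3) \<Rightarrow> R3 set" where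
  "lattice_of v = {(\<Sum>i\<in>UNIV. of_int (n i) *\<^sub>R v i) | n :: 3 \<Rightarrow> int. True}"

definition unit_cell :: "(3 \<Rightarrow> R3) \<Rightarrow> R3 set" where
  "unit_cell v = {(\<Sum>i\<in>UNIV. c i *\<^sub>R v i) | c :: 3 \<Rightarrow> real. \<forall>i. 0 \<le> c i \<and> c i < 1}"

definition periodic_with_basis :: "(3 \<Rightarrow> R3) \<Rightarrow> R3 set \<Rightarrow> bool" where
  "periodic_with_basis v A \<longleftrightarrow> basis3 v \<and>
     (\<exists>M. finite M \<and> M \<noteq> {} \<and> M \<subseteq> unit_cell v \<and> A = {x + p | x p. x \<in> M \<and> p \<in> lattice_of v})"

definition packing_radius :: "R3 set \<Rightarrow> real" where
  "packing_radius A = (GREATEST r. \<forall>x. \<forall>a\<in>A \<inter> ball x r. \<forall>b\<in>A \<inter> ball x r. a = b)"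

definition covering_radius :: "R3 set \<Rightarrow> real" where
  "covering_radius A = (LEAST R. \<forall>x. A \<inter> cball x R \<noteq> {})"

definition covered_at_least :: "nat \<Rightarrow> R3 set \<Rightarrow> real \<Rightarrow> R3 set" where
  "covered_at_least k A t = {x. \<exists>F\<subseteq>A. finite F \<and> card F = k \<and> (\<forall>a\<in>F. x \<in> cball a t)}"

text \<open>A periodic set has many bases. The density functions do not depend on which of them is taken, but
  their definition mentions the unit cell, so the basis is an explicit argument here. The partial
  application \<open>density_function v A\<close> is the density fingerprint of \<open>A\<close>.\<close>

definition cover_fraction :: "(3 \<Rightarrow> R3) \<Rightarrow> R3 set \<Rightarrow> nat \<Rightarrow> real \<Rightarrow> real" where
  "cover_fraction v A k t =
     measure lebesgue (unit_cell v \<inter> covered_at_least k A t) / measure lebesgue (unit_cell v)"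

definition density_function :: "(3 \<Rightarrow> R3) \<Rightarrow> R3 set \<Rightarrow> nat \<Rightarrow> real \<Rightarrow> real" where
  "density_function v A k t = cover_fraction v A k t - cover_fraction v A (Suc k) t"

definition bottleneck_dist :: "R3 set \<Rightarrow> R3 set \<Rightarrow> ereal" where
  "bottleneck_dist A Q = (INF \<gamma>\<in>{\<gamma>. bij_betw \<gamma> A Q}. SUP a\<in>A. ereal (norm (a - \<gamma> a)))"

text \<open>\<open>\<Psi>\<close> and \<open>\<Phi>\<close> are sequences of functions on \<open>[0,\<infinity>)\<close>; their values at negative arguments are ignored.\<close>

definition fingerprint_dist :: "(nat \<Rightarrow> real \<Rightarrow> real) \<Rightarrow> (nat \<Rightarrow> real \<Rightarrow> real) \<Rightarrow> ereal" where
  "fingerprint_dist \<Psi> \<Phi> =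
     (SUP k. ereal ((real k + 1) powr (- 2 / 3)) * (SUP t\<in>{0..}. ereal \<bar>\<Psi> k t - \<Phi> k t\<bar>))"


subsection \<open>The packing and covering radius of a periodic set exist\<close>

lemma lattice_norm_bounded_below:
  assumes "basis3 v"
  shows "\<exists>e>0. \<forall>p\<in>lattice_of v. p \<noteq> 0 \<longrightarrow> e \<le> norm p"
proof -
  define T :: "R3 \<Rightarrow> R3" where "T = (\<lambda>c. \<Sum>i\<in>UNIV. (c $ i) *\<^sub>R v i)"
  have lin: "linear T"
    unfolding T_def by (rule linearI) (auto simp: algebra_simps sum.distrib scaleR_sum_right)
  have inj: "inj T"
  proof (subst linear_injective_0[OF lin], intro allI impI)
    fix c assume "T c = 0"
    have iv: "inj v" and ind: "independent (range v)" using assms by (auto simp: basis3_def)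
    have "(\<Sum>w\<in>range v. (c $ (inv v w)) *\<^sub>R w) = T c"
      unfolding T_def using iv by (simp add: sum.reindex)
    then have "(\<Sum>w\<in>range v. (c $ (inv v w)) *\<^sub>R w) = 0" using \<open>T c = 0\<close> by simp
    then have "c $ (inv v w) = 0" if "w \<in> range v" for w
      using independentD[OF ind finite_imageI[OF finite] order_refl, of "\<lambda>w. c $ (inv v w)"] that by blast
    then have "c $ i = 0" for i using iv by (metis inv_f_f rangeI)
    then show "c = 0" by (simp add: vec_eq_iff)
  qed
  obtain B where B: "B > 0" "\<And>x. B * norm x \<le> norm (T x)"
    using linear_inj_bounded_below_pos[OF lin inj] by (auto simp: mult.commute)
  have "B \<le> norm p" if "p \<in> lattice_of v" "p \<noteq> 0" for p
  proof -
    obtain n :: "3 \<Rightarrow> int" where n: "p = T (\<chi> i. of_int (n i))"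
      using \<open>p \<in> lattice_of v\<close> by (auto simp: lattice_of_def T_def)
    have "\<exists>i. n i \<noteq> 0"
      using \<open>p \<noteq> 0\<close> unfolding n T_def by (rule contrapos_np) simp
    then obtain i where "n i \<noteq> 0" by blast
    then have "1 \<le> \<bar>(\<chi> i. real_of_int (n i)) $ i\<bar>" by simp
    also have "\<dots> \<le> norm (\<chi> i. real_of_int (n i))" by (rule component_le_norm_cart)
    finally have "B * 1 \<le> B * norm (\<chi> i. real_of_int (n i))" using B(1) by (intro mult_left_mono) auto
    then show ?thesis using B(2) n by (metis mult.right_neutral order_trans)
  qed
  then show ?thesis using B(1) by blast
qed

lemma lattice_diff:
  assumes "p \<in> lattice_of v" "q \<in> lattice_of v" shows "p - q \<in> lattice_of v"
proof -
  obtain m n :: "3 \<Rightarrow> int" where "p = (\<Sum>i\<in>UNIV. of_int (m i) *\<^sub>R v i)" "q = (\<Sum>i\<in>UNIV. of_int (n i) *\<^sub>R v i)"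
    using assms by (auto simp: lattice_of_def)
  then have "p - q = (\<Sum>i\<in>UNIV. of_int (m i - n i) *\<^sub>R v i)"
    by (simp add: sum_subtractf scaleR_left_diff_distrib)
  then show ?thesis unfolding lattice_of_def by (intro CollectI exI[of _ "\<lambda>i. m i - n i"] conjI TrueI)
qed

lemma closed_lattice:
  assumes "basis3 v" shows "closed (lattice_of v)"
proof -
  obtain e where e: "e > 0" "\<And>p. p \<in> lattice_of v \<Longrightarrow> p \<noteq> 0 \<Longrightarrow> e \<le> norm p"
    using lattice_norm_bounded_below[OF assms] by blast
  show ?thesis
  proof (rule discrete_imp_closed[OF e(1)], intro ballI impI)
    fix x y assume "x \<in> lattice_of v" "y \<in> lattice_of v" "dist y x < e"
    then show "y = x" using e(2)[OF lattice_diff[of y v x]] by (auto simp: dist_norm)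
  qed
qed

lemma periodic_set_closed:
  assumes "periodic_with_basis v A" shows "closed A"
proof -
  obtain M where v: "basis3 v" and M: "finite M" "A = {x + p | x p. x \<in> M \<and> p \<in> lattice_of v}"
    using assms by (auto simp: periodic_with_basis_def)
  have "A = (\<Union>x\<in>M. (+) x ` lattice_of v)" unfolding M by auto
  then show ?thesis using M(1) closed_lattice[OF v] by (auto intro: closed_translation)
qed

lemma periodic_set_two_points:
  assumes "periodic_with_basis v A"
  shows "\<exists>a\<in>A. \<exists>b\<in>A. a \<noteq> b"
proof -
  obtain M where v: "basis3 v" and M: "M \<noteq> {}" "A = {x + p | x p. x \<in> M \<and> p \<in> lattice_of v}"
    using assms by (auto simp: periodic_with_basis_def)
  obtain x where "x \<in> M" using M by blast
  have "0 \<in> lattice_of v" unfolding lattice_of_def by (auto intro!: exI[of _ "\<lambda>_. 0"])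
  moreover have "v 1 \<in> lattice_of v" unfolding lattice_of_def
    by (auto intro!: exI[of _ "\<lambda>i. if i = 1 then 1 else 0"] simp: sum.delta if_distrib if_distribR cong: if_cong)
  moreover have "v 1 \<noteq> 0" using v unfolding basis3_def by (metis dependent_zero rangeI)
  ultimately show ?thesis using \<open>x \<in> M\<close> unfolding M
    by (metis (mono_tags, lifting) add_left_cancel mem_Collect_eq)
qed

lemma periodic_set_relatively_dense:
  assumes "periodic_with_basis v A"
  shows "\<exists>R. \<forall>x. \<exists>a\<in>A. dist x a \<le> R"
proof -
  obtain M where v: "basis3 v" and M: "M \<noteq> {}" "A = {x + p | x p. x \<in> M \<and> p \<in> lattice_of v}"
    using assms by (auto simp: periodic_with_basis_def)
  obtain m where m: "m \<in> M" using M by blast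
  have iv: "inj v" and ind: "independent (range v)" using v by (auto simp: basis3_def)
  have "card (range v) = 3" using iv by (simp add: card_image)
  then have span: "span (range v) = UNIV"
    using ind card_ge_dim_independent[of "range v" UNIV] by auto
  have "\<exists>a\<in>A. dist x a \<le> (\<Sum>i\<in>UNIV. norm (v i)) + norm m" for x
  proof -
    have "x \<in> span (range v)" using span by simp
    then obtain u where "x = (\<Sum>w\<in>range v. u w *\<^sub>R w)" by (auto simp: span_finite)
    then have x: "x = (\<Sum>i\<in>UNIV. u (v i) *\<^sub>R v i)" using iv by (simp add: sum.reindex)
    define p where "p = (\<Sum>i\<in>UNIV. of_int \<lfloor>u (v i)\<rfloor> *\<^sub>R v i)"
    have p: "p \<in> lattice_of v" unfolding p_def lattice_of_def by (intro CollectI exI conjI TrueI) (rule refl)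
    have "norm (x - p) = norm (\<Sum>i\<in>UNIV. frac (u (v i)) *\<^sub>R v i)"
      unfolding x p_def frac_def by (simp add: sum_subtractf algebra_simps)
    also have "\<dots> \<le> (\<Sum>i\<in>UNIV. norm (v i))"
      by (rule sum_norm_le) (auto intro!: mult_left_le_one_le simp: frac_ge_0 less_imp_le[OF frac_lt_1])
    finally have "norm (x - p) \<le> (\<Sum>i\<in>UNIV. norm (v i))" .
    then have "dist x (m + p) \<le> (\<Sum>i\<in>UNIV. norm (v i)) + norm m"
      unfolding dist_norm using norm_triangle_ineq4[of "x - p" m] by (simp add: algebra_simps)
    then show ?thesis using m p M by blast
  qed
  then show ?thesis by blast
qed

lemma packing_radius_greatest:
  assumes "periodic_with_basis v A"
  shows "\<forall>x. \<forall>a\<in>A \<inter> ball x (packing_radius A). \<forall>b\<in>A \<inter> ball x (packing_radius A). a = b"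
    and "(\<And>x a b. a \<in> A \<inter> ball x r \<Longrightarrow> b \<in> A \<inter> ball x r \<Longrightarrow> a = b) \<Longrightarrow> r \<le> packing_radius A"
proof -
  define P where "P = (\<lambda>r. \<forall>x. \<forall>a\<in>A \<inter> ball x r. \<forall>b\<in>A \<inter> ball x r. a = b)"
  define s where "s = Sup (Collect P)"
  obtain a b where ab: "a \<in> A" "b \<in> A" "a \<noteq> b" using periodic_set_two_points[OF assms] by blast
  have P0: "P 0" by (auto simp: P_def)
  have bdd: "bdd_above (Collect P)"
  proof (rule bdd_aboveI)
    fix r assume "r \<in> Collect P"
    then have "\<not> (a \<in> ball a r \<and> b \<in> ball a r)" using ab unfolding P_def by blast
    then show "r \<le> dist a b" using ab by (auto simp: not_less) (smt (verit) zero_le_dist)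
  qed
  have up: "r \<le> s" if "P r" for r unfolding s_def using that bdd by (auto intro: cSup_upper)
  have Ps: "P s" unfolding P_def
  proof (intro allI ballI)
    fix x c d assume cd: "c \<in> A \<inter> ball x s" "d \<in> A \<inter> ball x s"
    then have "max (dist x c) (dist x d) < s" by auto
    then obtain r where "P r" "max (dist x c) (dist x d) < r"
      unfolding s_def using P0 less_cSupE[of _ "Collect P"] by blast
    then show "c = d" using cd unfolding P_def by auto
  qed
  have eq: "packing_radius A = s"
    unfolding packing_radius_def using Ps up by (intro Greatest_equality) (simp_all add: P_def)
  show "\<forall>x. \<forall>a\<in>A \<inter> ball x (packing_radius A). \<forall>b\<in>A \<inter> ball x (packing_radius A). a = b"
    using Ps unfolding eq P_def .
  show "r \<le> packing_radius A" if "\<And>x a b. a \<in> A \<inter> ball x r \<Longrightarrow> b \<in> A \<inter> ball x r \<Longrightarrow> a = b"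
    unfolding eq by (rule up) (use that in \<open>auto simp: P_def\<close>)
qed

lemma covering_radius_least:
  assumes "periodic_with_basis v A"
  shows "\<forall>x. A \<inter> cball x (covering_radius A) \<noteq> {}"
    and "(\<And>x. A \<inter> cball x R \<noteq> {}) \<Longrightarrow> covering_radius A \<le> R"
proof -
  have cl: "closed A" and ne: "A \<noteq> {}"
    using periodic_set_closed periodic_set_two_points assms by blast+
  have iff: "A \<inter> cball x R \<noteq> {} \<longleftrightarrow> infdist x A \<le> R" for x R
  proof
    assume "A \<inter> cball x R \<noteq> {}"
    then obtain a where "a \<in> A" "dist x a \<le> R" by auto
    then show "infdist x A \<le> R" by (rule infdist_le2)
  next
    assume R: "infdist x A \<le> R"
    obtain a where "a \<in> A" "infdist x A = dist x a"
      using infdist_attains_inf[OF cl ne] by blast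
    then have "a \<in> A \<inter> cball x R" using R by simp
    then show "A \<inter> cball x R \<noteq> {}" by blast
  qed
  obtain R0 where R0: "\<And>x. \<exists>a\<in>A. dist x a \<le> R0"
    using periodic_set_relatively_dense[OF assms] by blast
  have "infdist x A \<le> R0" for x
    using R0[of x] infdist_le2 by blast
  then have bdd: "bdd_above (range (\<lambda>x. infdist x A))"
    by (intro bdd_aboveI[of _ R0]) blast
  have le: "infdist x A \<le> (SUP x. infdist x A)" for x by (rule cSUP_upper[OF UNIV_I bdd])
  have least: "(SUP x. infdist x A) \<le> R" if "\<forall>x. A \<inter> cball x R \<noteq> {}" for R
    using that iff by (intro cSUP_least) auto
  have eq: "covering_radius A = (SUP x. infdist x A)"
    unfolding covering_radius_def using iff le by (intro Least_equality least) auto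
  show "\<forall>x. A \<inter> cball x (covering_radius A) \<noteq> {}"
    using iff le eq by auto
  show "covering_radius A \<le> R" if "\<And>x. A \<inter> cball x R \<noteq> {}"
    using that least eq by auto
qed

end

(* The fraction of a unit cell filled by a lattice-invariant set is its asymptotic density in large
   balls, which no longer refers to a lattice, so sets with incommensurable lattices can be compared.
   A bijection moving points by at most e gives phi_k^A(t - e) <= phi_k^Q(t). The remaining difference
   phi_k^A(t) - phi_k^A(t - e) is at most the density of the union of the shells of radii t - e and t
   around the points of A, which is O(t^2 e) by the packing radius. By the covering radius both phi_k
   equal 1 as soon as t >= 2 R (k + 1)^(1/3), so only t^2 = O((k + 1)^(2/3)) matters. *)

theory Submission
  imports Defs
begin

section \<open>Volumes and separated sets\<close>

lemma measure_cball_R3: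
  fixes c :: R3
  assumes "0 \<le> s"
  shows "measure lborel (cball c s) = unit_ball_vol 3 * s ^ 3"
  using content_cball[OF assms, of c] by simp

text \<open>The bound is linear in \<open>e\<close> on the whole range: for \<open>e > t\<close> the
  inner ball is empty and t^3 <= 3 t^2 e holds directly.\<close>

lemma measure_shell_le:
  fixes a :: R3
  assumes "0 \<le> t" "0 \<le> e"
  shows "measure lebesgue (cball a t - cball a (t - e)) \<le> unit_ball_vol 3 * (3 * t\<^sup>2 * e)"
proof (cases "e \<le> t")
  case True
  have "measure lebesgue (cball a t - cball a (t - e)) =
      measure lebesgue (cball a t) - measure lebesgue (cball a (t - e))"
    using assms by (intro measurable_measure_Diff) auto
  also have "\<dots> = unit_ball_vol 3 * (t ^ 3 - (t - e) ^ 3)"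
    using True assms by (simp add: measure_cball_R3 algebra_simps)
  also have "t ^ 3 - (t - e) ^ 3 = 3 * t\<^sup>2 * e - e\<^sup>2 * (3 * t - e)"
    by (simp add: power2_eq_square power3_eq_cube algebra_simps)
  \<comment> \<open>The dropped term e^2 (3 t - e) is nonnegative because 0 <= e <= t.\<close>
  also have "\<dots> \<le> 3 * t\<^sup>2 * e"
    using True assms by simp
  finally show ?thesis by (simp add: mult_left_mono)
next
  case False
  have "measure lebesgue (cball a t - cball a (t - e)) \<le> measure lebesgue (cball a t)"
    by (intro measure_mono_fmeasurable) (auto simp: lmeasurable_cball)
  also have "\<dots> = unit_ball_vol 3 * (t\<^sup>2 * t)"
    using measure_cball_R3[OF assms(1), of a] by (simp add: power2_eq_square power3_eq_cube)
  also have "\<dots> \<le> unit_ball_vol 3 * (t\<^sup>2 * (3 * e))"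
    using False assms by (intro mult_left_mono) auto
  finally show ?thesis by (simp add: algebra_simps)
qed

lemma finite_separated_Int_cball:
  fixes A :: "R3 set"
  assumes "0 < d" and sep: "\<And>a b. a \<in> A \<Longrightarrow> b \<in> A \<Longrightarrow> a \<noteq> b \<Longrightarrow> d \<le> dist a b"
  shows "finite (A \<inter> cball x s)"
proof -
  have "uniform_discrete (A \<inter> cball x s)"
    unfolding uniform_discrete_def using assms by (metis IntD1 not_le)
  then show ?thesis
    using uniform_discrete_finite_iff bounded_subset[OF bounded_cball] by (metis Int_lower2)
qed

text \<open>Open balls of radius \<open>r\<close> around the counted points are disjoint and lie in
  the ball of radius \<open>s + r\<close>; compare volumes.\<close>

lemma card_separated_Int_cball_le:
  fixes A :: "R3 set"
  assumes "0 < r" "0 \<le> s"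
    and sep: "\<And>a b. a \<in> A \<Longrightarrow> b \<in> A \<Longrightarrow> a \<noteq> b \<Longrightarrow> 2 * r \<le> dist a b"
  shows "real (card (A \<inter> cball x s)) * r ^ 3 \<le> (s + r) ^ 3"
proof -
  let ?F = "A \<inter> cball x s"
  have fin: "finite ?F" using finite_separated_Int_cball[of "2 * r" A] assms by auto
  have ball: "measure lebesgue (ball a r) = unit_ball_vol 3 * r ^ 3" for a :: R3
    using content_ball[of r a] assms(1) by simp
  have "pairwise (\<lambda>a b. disjnt (ball a r) (ball b r)) ?F"
    using sep by (auto simp: pairwise_def disjnt_def disjoint_ballI)
  then have "measure lebesgue (\<Union>a\<in>?F. ball a r) = real (card ?F) * (unit_ball_vol 3 * r ^ 3)"
    using fin by (subst measure_UNION') (auto simp: ball)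
  moreover have "measure lebesgue (\<Union>a\<in>?F. ball a r) \<le> measure lebesgue (cball x (s + r))"
  proof (intro measure_mono_fmeasurable)
    show "(\<Union>a\<in>?F. ball a r) \<subseteq> cball x (s + r)"
    proof
      fix z assume "z \<in> (\<Union>a\<in>?F. ball a r)"
      then obtain a where "dist x a \<le> s" "dist a z < r" by auto
      then show "z \<in> cball x (s + r)" using dist_triangle[of x z a] by auto
    qed
  qed (auto intro!: lmeasurable_cball sets_completionI_sets borel_open open_UN)
  ultimately have "real (card ?F) * (unit_ball_vol 3 * r ^ 3) \<le> unit_ball_vol 3 * (s + r) ^ 3"
    using assms measure_cball_R3[of "s + r" x] by simp
  then have "unit_ball_vol 3 * (real (card ?F) * r ^ 3) \<le> unit_ball_vol 3 * (s + r) ^ 3"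
    by (simp add: algebra_simps)
  then show ?thesis by (rule mult_left_le_imp_le) simp
qed

text \<open>Divide by T^3 and let T tend to infinity. This discards boundary effects: enlarging a
  ball by a constant does not change an asymptotic density.\<close>

lemma cubic_growth_le:
  fixes a b c :: real
  assumes "\<And>T. 0 \<le> T \<Longrightarrow> a * T ^ 3 \<le> b * (T + c) ^ 3"
  shows "a \<le> b"
proof (rule tendsto_le)
  show "((\<lambda>T::real. a) \<longlongrightarrow> a) at_top" by simp
  have "((\<lambda>T. b * (1 + c / T) ^ 3) \<longlongrightarrow> b * (1 + 0) ^ 3) at_top"
    by (intro tendsto_intros tendsto_divide_0[OF tendsto_const] filterlim_at_top_imp_at_infinity filterlim_ident)
  then show "((\<lambda>T. b * (1 + c / T) ^ 3) \<longlongrightarrow> b) at_top" by simp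
  show "\<forall>\<^sub>F T in at_top. a \<le> b * (1 + c / T) ^ 3"
  proof (intro eventually_mono[OF eventually_gt_at_top[of 0]])
    fix T :: real assume "0 < T"
    then have "a * T ^ 3 \<le> (b * (1 + c / T) ^ 3) * T ^ 3"
      using assms[of T] by (simp add: power_mult_distrib[symmetric] distrib_right mult.assoc)
    then show "a \<le> b * (1 + c / T) ^ 3" using \<open>0 < T\<close> by simp
  qed
qed simp

section \<open>Volume fractions of lattice-invariant sets\<close>

text \<open>The map from coefficients to vectors is injective by independence, hence an isomorphism,
  and \<open>c\<close> is its inverse. In these coordinates the cell is the half-open unit
  cube.\<close>

lemma basis3_coordinates:
  assumes "basis3 v"
  obtains c :: "R3 \<Rightarrow> R3" where "linear c"
    and "\<And>u. c (\<Sum>i\<in>UNIV. u i *\<^sub>R v i) = (\<chi> i. u i)"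
    and "\<And>x. x \<in> unit_cell v \<longleftrightarrow> (\<forall>i. 0 \<le> c x $ i \<and> c x $ i < 1)"
proof -
  define T :: "R3 \<Rightarrow> R3" where "T = (\<lambda>c. \<Sum>i\<in>UNIV. (c $ i) *\<^sub>R v i)"
  have lin: "linear T"
    unfolding T_def by (rule linearI) (auto simp: algebra_simps sum.distrib scaleR_sum_right)
  have iv: "inj v" and ind: "independent (range v)" using assms by (auto simp: basis3_def)
  have "inj T"
  proof (subst linear_injective_0[OF lin], intro allI impI)
    fix c assume "T c = 0"
    \<comment> \<open>Independence concerns the set \<open>range v\<close>, so the sum over indices
      is rewritten as a sum over vectors; injectivity of \<open>v\<close> permits this.\<close>
    then have "(\<Sum>w\<in>range v. (c $ inv v w) *\<^sub>R w) = 0"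
      using iv by (simp add: T_def sum.reindex)
    then have "c $ inv v w = 0" if "w \<in> range v" for w
      using independentD[OF ind finite_imageI[OF finite] order_refl, of "\<lambda>w. c $ inv v w"] that by blast
    then show "c = 0" using iv by (metis inv_f_f rangeI vec_eq_iff zero_index)
  qed
  then obtain c where c: "linear c" "\<And>x. c (T x) = x" "\<And>x. T (c x) = x"
    using linear_injective_isomorphism[OF lin] by blast
  show thesis
  proof (rule that[OF c(1)])
    show cT: "c (\<Sum>i\<in>UNIV. u i *\<^sub>R v i) = (\<chi> i. u i)" for u
      using c(2)[of "\<chi> i. u i"] by (simp add: T_def)
    show "x \<in> unit_cell v \<longleftrightarrow> (\<forall>i. 0 \<le> c x $ i \<and> c x $ i < 1)" for x
    proof
      show "x \<in> unit_cell v \<Longrightarrow> \<forall>i. 0 \<le> c x $ i \<and> c x $ i < 1"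
        by (auto simp: unit_cell_def cT)
      have "x = (\<Sum>i\<in>UNIV. (c x $ i) *\<^sub>R v i)" using c(3)[of x] by (simp add: T_def)
      then show "\<forall>i. 0 \<le> c x $ i \<and> c x $ i < 1 \<Longrightarrow> x \<in> unit_cell v"
        unfolding unit_cell_def by (intro CollectI exI[of _ "\<lambda>i. c x $ i"] conjI)
    qed
  qed
qed

lemma lattice_zero: "0 \<in> lattice_of v"
  unfolding lattice_of_def by (auto intro!: exI[of _ "\<lambda>_. 0"])

lemma lattice_uminus: "p \<in> lattice_of v \<Longrightarrow> - p \<in> lattice_of v"
  using lattice_diff[OF lattice_zero, of p] by simp

lemma lattice_add: "p \<in> lattice_of v \<Longrightarrow> q \<in> lattice_of v \<Longrightarrow> p + q \<in> lattice_of v"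
  using lattice_diff[OF _ lattice_uminus, of p v q] by simp

lemma finite_lattice_Int_cball:
  assumes "basis3 v"
  shows "finite (lattice_of v \<inter> cball x s)"
proof -
  obtain e where e: "e > 0" "\<And>p. p \<in> lattice_of v \<Longrightarrow> p \<noteq> 0 \<Longrightarrow> e \<le> norm p"
    using lattice_norm_bounded_below[OF assms] by blast
  then show ?thesis
    using finite_separated_Int_cball[OF e(1), of "lattice_of v"] by (simp add: dist_norm lattice_diff)
qed

text \<open>The lattice vector is obtained by rounding down each coordinate; half-openness of the
  cell makes it unique.\<close>

lemma unit_cell_tiling:
  assumes "basis3 v"
  shows "\<exists>!p. p \<in> lattice_of v \<and> x - p \<in> unit_cell v"
proof -
  obtain c where c: "linear c" "\<And>u. c (\<Sum>i\<in>UNIV. u i *\<^sub>R v i) = (\<chi> i. u i)"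
    and cell: "\<And>x. x \<in> unit_cell v \<longleftrightarrow> (\<forall>i. 0 \<le> c x $ i \<and> c x $ i < 1)"
    using basis3_coordinates[OF assms] by blast
  let ?p = "\<Sum>i\<in>UNIV. of_int \<lfloor>c x $ i\<rfloor> *\<^sub>R v i"
  show ?thesis
  proof (rule ex1I[of _ ?p], intro conjI)
    show "?p \<in> lattice_of v" unfolding lattice_of_def by (intro CollectI exI conjI TrueI) (rule refl)
    show "x - ?p \<in> unit_cell v"
      unfolding cell linear_diff[OF c(1)] c(2) by (simp add: algebra_simps floor_less_iff) linarith
  next
    fix p assume p: "p \<in> lattice_of v \<and> x - p \<in> unit_cell v"
    then obtain n :: "3 \<Rightarrow> int" where n: "p = (\<Sum>i\<in>UNIV. of_int (n i) *\<^sub>R v i)"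
      by (auto simp: lattice_of_def)
    have "c (x - p) = c x - (\<chi> i. of_int (n i))"
      by (simp only: linear_diff[OF c(1)] n c(2))
    then have "0 \<le> c x $ i - of_int (n i) \<and> c x $ i - of_int (n i) < 1" for i
      using p by (simp add: cell)
    then have "\<lfloor>c x $ i\<rfloor> = n i" for i by (simp add: floor_eq_iff algebra_simps)
    then show "p = ?p" by (simp only: n)
  qed
qed

lemma unit_cell_norm_bounded:
  "x \<in> unit_cell v \<Longrightarrow> norm x \<le> (\<Sum>i\<in>UNIV. norm (v i))"
  unfolding unit_cell_def by (auto intro!: sum_norm_le mult_left_le_one_le) (use less_imp_le in blast)

text \<open>The cell is bounded, and Borel as a finite intersection of open and closed half-spaces
  given by the continuous coordinates.\<close>

lemma unit_cell_lmeasurable: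
  assumes "basis3 v"
  shows "unit_cell v \<in> lmeasurable"
proof (rule bounded_set_imp_lmeasurable)
  show "bounded (unit_cell v)"
    using unit_cell_norm_bounded by (auto simp: bounded_iff)
  obtain c where c: "linear c" and "\<And>u. c (\<Sum>i\<in>UNIV. u i *\<^sub>R v i) = (\<chi> i. u i)"
    and cell: "\<And>x. x \<in> unit_cell v \<longleftrightarrow> (\<forall>i. 0 \<le> c x $ i \<and> c x $ i < 1)"
    using basis3_coordinates[OF assms] by blast
  have cont: "continuous_on UNIV (\<lambda>y. c y $ i)" for i
    by (rule continuous_on_component[OF linear_continuous_on[OF linear_conv_bounded_linear[THEN iffD1, OF c]]])
  have "{y. 0 \<le> c y $ i} \<inter> {y. c y $ i < 1} \<in> sets borel" for i
    by (intro sets.Int borel_closed borel_open closed_Collect_le open_Collect_less cont continuous_on_const)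
  then have "(\<Inter>i. {y. 0 \<le> c y $ i} \<inter> {y. c y $ i < 1}) \<in> sets borel"
    by (intro sets.finite_INT) auto
  moreover have "unit_cell v = (\<Inter>i. {y. 0 \<le> c y $ i} \<inter> {y. c y $ i < 1})"
    by (auto simp: cell)
  ultimately show "unit_cell v \<in> sets lebesgue" by simp
qed

text \<open>An inclusion suffices in place of the equality S + p = S, since the lattice is closed
  under negation.\<close>

definition lattice_invariant :: "(3 \<Rightarrow> R3) \<Rightarrow> R3 set \<Rightarrow> bool" where
  "lattice_invariant v S \<longleftrightarrow> (\<forall>p\<in>lattice_of v. \<forall>x\<in>S. x + p \<in> S)"

lemma lattice_invariant_diff:
  assumes "lattice_invariant v S" "x \<in> S" "p \<in> lattice_of v"
  shows "x - p \<in> S"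
proof -
  have "x + - p \<in> S"
    using assms lattice_uminus[of p v] unfolding lattice_invariant_def by blast
  then show ?thesis by simp
qed

lemma lattice_invariant_Diff:
  assumes "lattice_invariant v S" "lattice_invariant v T"
  shows "lattice_invariant v (S - T)"
  unfolding lattice_invariant_def
proof (intro ballI)
  fix p x assume "p \<in> lattice_of v" "x \<in> S - T"
  then show "x + p \<in> S - T"
    using assms(1) lattice_invariant_diff[OF assms(2), of "x + p" p] by (auto simp: lattice_invariant_def)
qed

text \<open>The number \<open>N\<close> of cells meeting a ball must not depend on \<open>S\<close>: it cancels when the bounds for
  \<open>S\<close> and for the whole space are combined.\<close>

lemma measure_lattice_invariant_cball:
  assumes v: "basis3 v" and S: "lattice_invariant v S" "S \<in> sets lebesgue"
    and d: "d = (\<Sum>i\<in>UNIV. norm (v i))" and N: "N = real (card (lattice_of v \<inter> cball 0 (T + d)))"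
  shows "measure lebesgue (S \<inter> cball 0 T) \<le> N * measure lebesgue (unit_cell v \<inter> S)"
    and "N * measure lebesgue (unit_cell v \<inter> S) \<le> measure lebesgue (S \<inter> cball 0 (T + 2 * d))"
proof -
  let ?P = "lattice_of v \<inter> cball 0 (T + d)"
  let ?D = "unit_cell v \<inter> S"
  have fin: "finite ?P" using finite_lattice_Int_cball[OF v] .
  have D: "?D \<in> lmeasurable" by (intro fmeasurable_Int_fmeasurable unit_cell_lmeasurable v S)
  have tr: "(+) p ` ?D \<in> lmeasurable" for p using measurable_translation[OF D] .
  have U: "(\<Union>p\<in>?P. (+) p ` ?D) \<in> lmeasurable" using fin tr by (intro fmeasurable.finite_UN) auto
  have cb: "S \<inter> cball 0 s \<in> lmeasurable" for s
    using fmeasurable_Int_fmeasurable[OF lmeasurable_cball S(2)] by (simp add: Int_commute)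
  \<comment> \<open>Cell points have norm at most \<open>d\<close>, so a point of the ball of radius
    \<open>T\<close> lies in a translate by some \<open>p\<close> of norm at most
    \<open>T + d\<close>.\<close>
  have "measure lebesgue (S \<inter> cball 0 T) \<le> measure lebesgue (\<Union>p\<in>?P. (+) p ` ?D)"
  proof (intro measure_mono_fmeasurable)
    show "S \<inter> cball 0 T \<subseteq> (\<Union>p\<in>?P. (+) p ` ?D)"
    proof
      fix x assume x: "x \<in> S \<inter> cball 0 T"
      obtain p where p: "p \<in> lattice_of v" "x - p \<in> unit_cell v"
        using unit_cell_tiling[OF v, of x] by blast
      then have "norm p \<le> T + d"
        using x unit_cell_norm_bounded[OF p(2)] norm_triangle_ineq4[of x "x - p"] unfolding d by simp
      moreover have "x - p \<in> S" using lattice_invariant_diff[OF S(1)] x p(1) by simp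
      ultimately show "x \<in> (\<Union>p\<in>?P. (+) p ` ?D)"
        using p by (auto intro!: bexI[of _ p] image_eqI[of _ _ "x - p"])
    qed
  qed (use U cb in auto)
  also have "\<dots> \<le> (\<Sum>p\<in>?P. measure lebesgue ((+) p ` ?D))"
    using fin tr by (intro measure_UNION_le) auto
  also have "\<dots> = N * measure lebesgue ?D" by (simp add: measure_translation N)
  finally show "measure lebesgue (S \<inter> cball 0 T) \<le> N * measure lebesgue ?D" .
  \<comment> \<open>Uniqueness in the tiling makes the translates disjoint, so their volumes add up
    exactly; all of them stay within radius \<open>T + 2 * d\<close>.\<close>
  have "pairwise (\<lambda>p q. disjnt ((+) p ` ?D) ((+) q ` ?D)) ?P"
  proof (intro pairwiseI)
    fix p q assume pq: "p \<in> ?P" "q \<in> ?P" "p \<noteq> q"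
    show "disjnt ((+) p ` ?D) ((+) q ` ?D)"
      unfolding disjnt_iff
    proof (intro allI notI, elim conjE imageE IntE)
      fix x y z assume x: "x = p + y" "x = q + z" and "y \<in> unit_cell v" "z \<in> unit_cell v"
      then have "x - p \<in> unit_cell v" "x - q \<in> unit_cell v" using x by (metis add_diff_cancel_left')+
      then show False using pq unit_cell_tiling[OF v, of x] by blast
    qed
  qed
  then have "N * measure lebesgue ?D = measure lebesgue (\<Union>p\<in>?P. (+) p ` ?D)"
    using fin tr by (subst measure_UNION') (auto simp: measure_translation N)
  also have "\<dots> \<le> measure lebesgue (S \<inter> cball 0 (T + 2 * d))"
  proof (intro measure_mono_fmeasurable)
    show "(\<Union>p\<in>?P. (+) p ` ?D) \<subseteq> S \<inter> cball 0 (T + 2 * d)"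
    proof
      fix x assume "x \<in> (\<Union>p\<in>?P. (+) p ` ?D)"
      then obtain p y where x: "x = p + y" "p \<in> ?P" "y \<in> unit_cell v" "y \<in> S" by auto
      then have "norm x \<le> T + 2 * d"
        using unit_cell_norm_bounded[of y v] norm_triangle_ineq[of p y] unfolding d by simp
      moreover have "x \<in> S" using S(1) x by (auto simp: lattice_invariant_def add.commute)
      ultimately show "x \<in> S \<inter> cball 0 (T + 2 * d)" by simp
    qed
  qed (use U cb in auto)
  finally show "N * measure lebesgue ?D \<le> measure lebesgue (S \<inter> cball 0 (T + 2 * d))" .
qed

text \<open>Extends the quotient in \<open>cover_fraction\<close> to arbitrary sets, so that
  differences of covers and the whole space can be treated alike.\<close>

definition volume_fraction :: "(3 \<Rightarrow> R3) \<Rightarrow> R3 set \<Rightarrow> real" where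
  "volume_fraction v S = measure lebesgue (unit_cell v \<inter> S) / measure lebesgue (unit_cell v)"

lemma lattice_invariant_UNIV: "lattice_invariant v UNIV"
  by (simp add: lattice_invariant_def)

text \<open>Finitely many translates of the cell cover the unit ball, which has positive
  volume.\<close>

lemma measure_unit_cell_pos:
  assumes "basis3 v"
  shows "0 < measure lebesgue (unit_cell v)"
proof -
  let ?d = "\<Sum>i\<in>UNIV. norm (v i)"
  have "0 < measure lebesgue (cball (0::R3) 1)" by (simp add: measure_cball_R3)
  also have "\<dots> \<le> real (card (lattice_of v \<inter> cball 0 (1 + ?d))) * measure lebesgue (unit_cell v)"
    using measure_lattice_invariant_cball(1)[OF assms lattice_invariant_UNIV _ refl refl, of 1] by simp
  finally show ?thesis by (simp add: zero_less_mult_iff)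
qed

text \<open>Identifies the volume fraction with the density in large balls, up to a shift
  \<open>D\<close> of the radius. Counting cells for \<open>S\<close> and for the whole space with
  the same N eliminates the lattice.\<close>

lemma volume_fraction_bounds:
  assumes v: "basis3 v" and S: "lattice_invariant v S" "S \<in> sets lebesgue"
  obtains D where "0 \<le> D"
    and "\<And>T. 0 \<le> T \<Longrightarrow> unit_ball_vol 3 * T ^ 3 * volume_fraction v S
           \<le> measure lebesgue (S \<inter> cball 0 (T + D))"
    and "\<And>T. 0 \<le> T \<Longrightarrow> measure lebesgue (S \<inter> cball 0 T)
           \<le> unit_ball_vol 3 * (T + D) ^ 3 * volume_fraction v S"
proof -
  define d where "d = (\<Sum>i\<in>UNIV. norm (v i))"
  have "0 \<le> d" by (simp add: d_def sum_nonneg)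
  let ?U = "measure lebesgue (unit_cell v)"
  let ?m = "measure lebesgue (unit_cell v \<inter> S)"
  have pos: "0 < ?U" using measure_unit_cell_pos[OF v] .
  show thesis
  proof (rule that)
    show "0 \<le> 2 * d" using \<open>0 \<le> d\<close> by simp
  next
    fix T :: real assume "0 \<le> T"
    define N where "N = real (card (lattice_of v \<inter> cball 0 (T + d)))"
    note S' = measure_lattice_invariant_cball[OF v S d_def N_def]
      and U = measure_lattice_invariant_cball[OF v lattice_invariant_UNIV _ d_def N_def]
    have 1: "unit_ball_vol 3 * T ^ 3 \<le> N * ?U"
      using U(1) \<open>0 \<le> T\<close> by (simp add: measure_cball_R3)
    have 2: "N * ?U \<le> unit_ball_vol 3 * (T + 2 * d) ^ 3"
      using U(2) \<open>0 \<le> T\<close> \<open>0 \<le> d\<close> by (simp add: measure_cball_R3)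
    \<comment> \<open>Both chains pass through the product \<open>N * ?U * ?m\<close>, so
      \<open>N\<close> disappears without a division by it.\<close>
    have "unit_ball_vol 3 * T ^ 3 * ?m \<le> N * ?U * ?m"
      using 1 by (rule mult_right_mono) simp
    also have "\<dots> \<le> measure lebesgue (S \<inter> cball 0 (T + 2 * d)) * ?U"
      using mult_right_mono[OF S'(2), of ?U] by (simp add: algebra_simps)
    finally show "unit_ball_vol 3 * T ^ 3 * volume_fraction v S \<le> measure lebesgue (S \<inter> cball 0 (T + 2 * d))"
      using pos by (simp add: volume_fraction_def pos_divide_le_eq)
    have "measure lebesgue (S \<inter> cball 0 T) * ?U \<le> N * ?U * ?m"
      using mult_right_mono[OF S'(1), of ?U] by (simp add: algebra_simps)
    also have "\<dots> \<le> unit_ball_vol 3 * (T + 2 * d) ^ 3 * ?m"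
      using 2 by (rule mult_right_mono) simp
    finally show "measure lebesgue (S \<inter> cball 0 T) \<le> unit_ball_vol 3 * (T + 2 * d) ^ 3 * volume_fraction v S"
      using pos by (simp add: volume_fraction_def pos_le_divide_eq)
  qed
qed

text \<open>Reduces a bound on a volume fraction to a bound in large balls; the shifts
  \<open>D\<close> and \<open>c\<close> of the radius both vanish in the limit.\<close>

lemma volume_fraction_le:
  assumes "basis3 v" "lattice_invariant v S" "S \<in> sets lebesgue"
    and "\<And>T. 0 \<le> T \<Longrightarrow> measure lebesgue (S \<inter> cball 0 T) \<le> b * (unit_ball_vol 3 * (T + c) ^ 3)"
  shows "volume_fraction v S \<le> b"
proof -
  obtain D where D: "0 \<le> D" "\<And>T. 0 \<le> T \<Longrightarrow> unit_ball_vol 3 * T ^ 3 * volume_fraction v S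
           \<le> measure lebesgue (S \<inter> cball 0 (T + D))"
    using volume_fraction_bounds[OF assms(1-3)] by metis
  have "volume_fraction v S * T ^ 3 \<le> b * (T + (D + c)) ^ 3" if "0 \<le> T" for T
  proof -
    have "unit_ball_vol 3 * T ^ 3 * volume_fraction v S \<le> b * (unit_ball_vol 3 * ((T + D) + c) ^ 3)"
      using D(2)[OF that] assms(4)[of "T + D"] that D(1) by linarith
    then have "unit_ball_vol 3 * (volume_fraction v S * T ^ 3) \<le> unit_ball_vol 3 * (b * (T + (D + c)) ^ 3)"
      by (simp add: algebra_simps)
    then show ?thesis by (rule mult_left_le_imp_le) simp
  qed
  then show ?thesis by (rule cubic_growth_le)
qed

text \<open>The two cells are unrelated, so the inclusion cannot be applied inside one cell. It is
  applied inside large balls, where both fractions are visible as densities.\<close>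

lemma volume_fraction_mono:
  assumes "basis3 v" "lattice_invariant v S" "S \<in> sets lebesgue"
    and "basis3 w" "lattice_invariant w S'" "S' \<in> sets lebesgue" and "S \<subseteq> S'"
  shows "volume_fraction v S \<le> volume_fraction w S'"
proof -
  obtain D where D: "\<And>T. 0 \<le> T \<Longrightarrow> measure lebesgue (S' \<inter> cball 0 T)
           \<le> unit_ball_vol 3 * (T + D) ^ 3 * volume_fraction w S'"
    using volume_fraction_bounds[OF assms(4-6)] by metis
  show ?thesis
  proof (rule volume_fraction_le[OF assms(1-3)])
    fix T :: real assume "0 \<le> T"
    have "measure lebesgue (S \<inter> cball 0 T) \<le> measure lebesgue (S' \<inter> cball 0 T)"
      using assms fmeasurable_Int_fmeasurable[OF lmeasurable_cball assms(6)]
      by (intro measure_mono_fmeasurable) (auto simp: Int_commute)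
    then show "measure lebesgue (S \<inter> cball 0 T) \<le> volume_fraction w S' * (unit_ball_vol 3 * (T + D) ^ 3)"
      using D[OF \<open>0 \<le> T\<close>] by (simp add: algebra_simps)
  qed
qed

lemma volume_fraction_UNIV:
  "basis3 v \<Longrightarrow> volume_fraction v UNIV = 1"
  using measure_unit_cell_pos[of v] by (simp add: volume_fraction_def)

lemma volume_fraction_Diff:
  assumes "basis3 v" "S \<in> sets lebesgue" "T \<in> sets lebesgue" "T \<subseteq> S"
  shows "volume_fraction v (S - T) = volume_fraction v S - volume_fraction v T"
proof -
  have "unit_cell v \<inter> (S - T) = (unit_cell v \<inter> S) - (unit_cell v \<inter> T)" by blast
  moreover have "measure lebesgue ((unit_cell v \<inter> S) - (unit_cell v \<inter> T))
      = measure lebesgue (unit_cell v \<inter> S) - measure lebesgue (unit_cell v \<inter> T)"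
    using assms fmeasurable_Int_fmeasurable[OF unit_cell_lmeasurable[OF assms(1)]]
    by (intro measurable_measure_Diff) auto
  ultimately show ?thesis by (simp add: volume_fraction_def diff_divide_distrib)
qed

section \<open>Multiple covers by balls around a periodic set\<close>

lemma cover_fraction_eq_volume_fraction:
  "cover_fraction v A k t = volume_fraction v (covered_at_least k A t)"
  by (simp add: cover_fraction_def volume_fraction_def)

text \<open>\<open>r\<close> is only a lower bound for the packing radius, so that two periodic sets
  can share it.\<close>

locale periodic_packing =
  fixes v :: "3 \<Rightarrow> R3" and A :: "R3 set" and r :: real
  assumes periodic: "periodic_with_basis v A"
    and r_pos: "0 < r" and r_le: "r \<le> packing_radius A"
begin

lemma basis: "basis3 v"
  using periodic by (simp add: periodic_with_basis_def)

text \<open>Two points closer than \<open>2 * r\<close> would both lie in the open ball of radius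
  \<open>packing_radius A\<close> around their midpoint.\<close>

lemma separated:
  assumes "a \<in> A" "b \<in> A" "a \<noteq> b"
  shows "2 * r \<le> dist a b"
proof (rule ccontr)
  assume "\<not> 2 * r \<le> dist a b"
  then have "a \<in> A \<inter> ball (midpoint a b) (packing_radius A)" "b \<in> A \<inter> ball (midpoint a b) (packing_radius A)"
    using assms r_le by (auto simp: dist_midpoint)
  then show False using packing_radius_greatest(1)[OF periodic] assms(3) by blast
qed

lemma finite_Int_cball: "finite (A \<inter> cball x s)"
  using finite_separated_Int_cball[of "2 * r" A] separated r_pos by simp

lemma countable_points: "countable A"
proof -
  have "A = (\<Union>n. A \<inter> cball 0 (real n))"
    using real_arch_simple by auto
  moreover have "countable (\<Union>n. A \<inter> cball 0 (real n))"
    by (intro countable_UN) (simp_all add: countable_finite finite_Int_cball)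
  ultimately show ?thesis by simp
qed

text \<open>A countable set has countably many subsets of size \<open>k\<close>, and each
  contributes a closed intersection of balls.\<close>

lemma covered_measurable: "covered_at_least k A t \<in> sets lebesgue"
proof -
  have "covered_at_least k A t = (\<Union>F\<in>{F. F \<subseteq> A \<and> finite F \<and> card F = k}. \<Inter>a\<in>F. cball a t)"
    by (auto simp: covered_at_least_def)
  moreover have "countable {F. F \<subseteq> A \<and> finite F \<and> card F = k}"
    by (rule countable_subset[OF _ countable_Collect_finite_subset[OF countable_points]]) auto
  ultimately have "covered_at_least k A t \<in> sets borel"
    by (simp only:) (intro sets.countable_UN'' borel_closed closed_INT ballI closed_cball)
  then show ?thesis by (simp add: sets_completionI_sets)
qed

lemma invariant: "lattice_invariant v A"
proof -
  obtain M where "A = {x + p | x p. x \<in> M \<and> p \<in> lattice_of v}"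
    using periodic by (auto simp: periodic_with_basis_def)
  then show ?thesis
    unfolding lattice_invariant_def using lattice_add[of _ v] by (fastforce simp: add.assoc)
qed

lemma covered_invariant: "lattice_invariant v (covered_at_least k A t)"
  unfolding lattice_invariant_def
proof (intro ballI)
  fix p x assume p: "p \<in> lattice_of v" and "x \<in> covered_at_least k A t"
  then obtain F where F: "F \<subseteq> A" "finite F" "card F = k" "\<And>a. a \<in> F \<Longrightarrow> dist a x \<le> t"
    by (auto simp: covered_at_least_def)
  then show "x + p \<in> covered_at_least k A t"
    unfolding covered_at_least_def using invariant p
    by (intro CollectI exI[of _ "(\<lambda>a. a + p) ` F"])
      (auto simp: lattice_invariant_def card_image dist_norm)
qed

lemma volume_fraction_shells_le:
  assumes "0 \<le> t" "0 \<le> e"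
  shows "volume_fraction v (covered_at_least k A t - covered_at_least k A (t - e)) \<le> 3 * t\<^sup>2 * e / r ^ 3"
proof (rule volume_fraction_le[OF basis])
  let ?S = "covered_at_least k A t - covered_at_least k A (t - e)"
  let ?shell = "\<lambda>a. cball a t - cball a (t - e)"
  show "lattice_invariant v ?S" by (intro lattice_invariant_Diff covered_invariant)
  show "?S \<in> sets lebesgue" by (intro sets.Diff covered_measurable)
  fix T :: real assume "0 \<le> T"
  let ?F = "A \<inter> cball 0 (T + t)"
  let ?N = "real (card ?F)"
  have "?S \<inter> cball 0 T \<subseteq> (\<Union>a\<in>?F. ?shell a)"
  proof
    fix x assume x: "x \<in> ?S \<inter> cball 0 T"
    then obtain F where F: "F \<subseteq> A" "finite F" "card F = k" "\<And>a. a \<in> F \<Longrightarrow> x \<in> cball a t"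
      by (auto simp: covered_at_least_def)
    \<comment> \<open>If every ball of radius \<open>t - e\<close> around a point of
      \<open>F\<close> contained \<open>x\<close>, then \<open>F\<close> would witness the cover at
      radius \<open>t - e\<close> too. So some centre has \<open>x\<close> in its shell.\<close>
    then obtain a where a: "a \<in> F" "x \<notin> cball a (t - e)"
      using x unfolding covered_at_least_def by blast
    moreover have "norm a \<le> T + t"
      using x F(4)[OF a(1)] dist_triangle[of 0 a x] by (simp add: dist_commute)
    ultimately show "x \<in> (\<Union>a\<in>?F. ?shell a)"
      using F(1) F(4)[OF a(1)] a by (intro UN_I[of a]) auto
  qed
  then have "measure lebesgue (?S \<inter> cball 0 T) \<le> measure lebesgue (\<Union>a\<in>?F. ?shell a)"
    using finite_Int_cball[of 0 "T + t"] covered_measurable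
    by (intro measure_mono_fmeasurable fmeasurable.finite_UN) (auto intro: fmeasurable.Diff lmeasurable_cball)
  also have "\<dots> \<le> (\<Sum>a\<in>?F. measure lebesgue (?shell a))"
    using finite_Int_cball[of 0 "T + t"] by (intro measure_UNION_le) auto
  also have "\<dots> \<le> (\<Sum>a\<in>?F. unit_ball_vol 3 * (3 * t\<^sup>2 * e))"
    by (intro sum_mono measure_shell_le assms)
  also have "\<dots> = ?N * (unit_ball_vol 3 * (3 * t\<^sup>2 * e))" by simp
  \<comment> \<open>The packing bound on the number of centres; it has cubic growth in
    \<open>T\<close>, with shift \<open>t + r\<close>.\<close>
  also have "\<dots> \<le> ((T + t + r) ^ 3 / r ^ 3) * (unit_ball_vol 3 * (3 * t\<^sup>2 * e))"
    using card_separated_Int_cball_le[of r "T + t" A 0] separated r_pos assms \<open>0 \<le> T\<close>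
    by (intro mult_right_mono) (simp_all add: pos_le_divide_eq)
  also have "\<dots> = 3 * t\<^sup>2 * e / r ^ 3 * (unit_ball_vol 3 * (T + (t + r)) ^ 3)"
    by (simp add: add.assoc)
  finally show "measure lebesgue (?S \<inter> cball 0 T) \<le> 3 * t\<^sup>2 * e / r ^ 3 * (unit_ball_vol 3 * (T + (t + r)) ^ 3)" .
qed

text \<open>Balls of radius \<open>R\<close> around the points of \<open>A\<close> within
  \<open>t\<close> of \<open>x\<close> cover the ball of radius \<open>t - R\<close> around
  \<open>x\<close>, so by volume there are at least ((t - R) / R)^3 of them. Using k + 1 in place of
  k keeps the cube root at least 1, also for k = 0.\<close>

lemma covered_at_least_UNIV:
  assumes "0 < R" "\<And>x. A \<inter> cball x R \<noteq> {}" and t: "2 * R * (real k + 1) powr (1 / 3) \<le> t"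
  shows "covered_at_least k A t = UNIV"
proof -
  have "x \<in> covered_at_least k A t" for x
  proof -
    let ?c = "(real k + 1) powr (1 / 3)"
    let ?F = "A \<inter> cball x t"
    have "1 \<le> ?c" by (simp add: ge_one_powr_ge_zero)
    \<comment> \<open>Explains the factor 2 in the threshold: one copy of \<open>R * ?c\<close> pays
      for the lost radius \<open>R\<close>, the other remains.\<close>
    then have "R * 1 \<le> R * ?c" using \<open>0 < R\<close> by (intro mult_left_mono) auto
    then have s: "R * ?c \<le> t - R" "0 \<le> t - R" using t \<open>0 < R\<close> by linarith+
    have c3: "?c ^ 3 = real k + 1" by (simp add: powr_power)
    have "cball x (t - R) \<subseteq> (\<Union>a\<in>?F. cball a R)"
    proof
      fix y assume y: "y \<in> cball x (t - R)"
      obtain a where "a \<in> A" "dist y a \<le> R" using assms(2)[of y] by auto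
      moreover have "dist x a \<le> t" using y \<open>dist y a \<le> R\<close> dist_triangle[of x a y] by simp
      ultimately show "y \<in> (\<Union>a\<in>?F. cball a R)" by (auto simp: dist_commute)
    qed
    then have "measure lebesgue (cball x (t - R)) \<le> measure lebesgue (\<Union>a\<in>?F. cball a R)"
      using finite_Int_cball[of x t]
      by (intro measure_mono_fmeasurable fmeasurable.finite_UN) (auto intro: lmeasurable_cball)
    also have "\<dots> \<le> (\<Sum>a\<in>?F. measure lebesgue (cball a R))"
      using finite_Int_cball[of x t] by (intro measure_UNION_le) auto
    finally have "unit_ball_vol 3 * (t - R) ^ 3 \<le> unit_ball_vol 3 * (real (card ?F) * R ^ 3)"
      using s(2) \<open>0 < R\<close> by (simp add: measure_cball_R3 algebra_simps)
    then have "(t - R) ^ 3 \<le> real (card ?F) * R ^ 3" by (rule mult_left_le_imp_le) simp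
    moreover have "(R * ?c) ^ 3 \<le> (t - R) ^ 3" using s(1) \<open>0 < R\<close> by (intro power_mono) auto
    ultimately have "R ^ 3 * (real k + 1) \<le> R ^ 3 * real (card ?F)"
      by (simp only: power_mult_distrib c3) (simp add: mult.commute)
    then have "real k + 1 \<le> real (card ?F)" using \<open>0 < R\<close> by simp
    then have "k \<le> card ?F" by linarith
    then obtain F where F: "F \<subseteq> ?F" "card F = k" "finite F"
      using obtain_subset_with_card_n by metis
    then show ?thesis
      unfolding covered_at_least_def by (intro CollectI exI[of _ F]) (auto simp: dist_commute)
  qed
  then show ?thesis by blast
qed

end

section \<open>Comparison of two periodic sets along a bijection\<close>

text \<open>The image of a witness under the bijection is again a witness: injectivity keeps its
  size and the triangle inequality costs \<open>e\<close>.\<close>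

lemma covered_at_least_subset:
  assumes \<gamma>: "bij_betw \<gamma> A Q" "\<And>a. a \<in> A \<Longrightarrow> norm (a - \<gamma> a) \<le> e"
  shows "covered_at_least k A (t - e) \<subseteq> covered_at_least k Q t"
proof
  fix x assume "x \<in> covered_at_least k A (t - e)"
  then obtain F where F: "F \<subseteq> A" "finite F" "card F = k" "\<And>a. a \<in> F \<Longrightarrow> dist a x \<le> t - e"
    by (auto simp: covered_at_least_def)
  have "dist (\<gamma> a) x \<le> t" if "a \<in> F" for a
    using F(4)[OF that] \<gamma>(2)[of a] F(1) that dist_triangle[of "\<gamma> a" x a] by (auto simp: dist_norm norm_minus_commute)
  moreover have "inj_on \<gamma> F" "\<gamma> ` F \<subseteq> Q"
    using \<gamma>(1) F(1) by (auto simp: bij_betw_def inj_on_subset)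
  ultimately show "x \<in> covered_at_least k Q t"
    unfolding covered_at_least_def using F
    by (intro CollectI exI[of _ "\<gamma> ` F"]) (auto simp: card_image)
qed

text \<open>One-sided; the other sign follows by exchanging the two sets and inverting the
  bijection.\<close>

lemma cover_fraction_diff_le:
  assumes A: "periodic_packing v A r" and Q: "periodic_packing w Q r"
    and R: "0 < R" "\<And>x. A \<inter> cball x R \<noteq> {}" "\<And>x. Q \<inter> cball x R \<noteq> {}"
    and \<gamma>: "bij_betw \<gamma> A Q" "\<And>a. a \<in> A \<Longrightarrow> norm (a - \<gamma> a) \<le> e"
    and t: "0 \<le> t" and e: "0 \<le> e"
  shows "cover_fraction v A k t - cover_fraction w Q k t \<le> 12 * R\<^sup>2 / r ^ 3 * (real k + 1) powr (2 / 3) * e"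
proof -
  interpret A: periodic_packing v A r by fact
  interpret Q: periodic_packing w Q r by fact
  let ?c = "(real k + 1) powr (1 / 3)"
  note r = A.r_pos
  show ?thesis
  proof (cases "2 * R * ?c \<le> t")
    case True
    then have "cover_fraction v A k t - cover_fraction w Q k t = 0"
      using A.covered_at_least_UNIV[OF R(1,2)] Q.covered_at_least_UNIV[OF R(1,3)]
      by (simp add: cover_fraction_eq_volume_fraction volume_fraction_UNIV A.basis Q.basis)
    then show ?thesis using r e by simp
  next
    case False
    have "volume_fraction v (covered_at_least k A (t - e)) \<le> volume_fraction w (covered_at_least k Q t)"
      using covered_at_least_subset[OF \<gamma>]
      by (intro volume_fraction_mono A.basis Q.basis A.covered_invariant Q.covered_invariant
          A.covered_measurable Q.covered_measurable)
    moreover have "covered_at_least k A (t - e) \<subseteq> covered_at_least k A t"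
      using e by (fastforce simp: covered_at_least_def)
    ultimately have "cover_fraction v A k t - cover_fraction w Q k t \<le> 3 * t\<^sup>2 * e / r ^ 3"
      using A.volume_fraction_shells_le[OF t e, of k]
      by (simp add: volume_fraction_Diff A.basis A.covered_measurable cover_fraction_eq_volume_fraction)
    \<comment> \<open>Below the threshold \<open>t\<close> is at most \<open>2 * R * ?c\<close>,
      which gives 12 = 3 * 2^2 and the exponent 2/3.\<close>
    also have "\<dots> \<le> 3 * (2 * R * ?c)\<^sup>2 * e / r ^ 3"
      using False t e r by (intro divide_right_mono mult_right_mono mult_left_mono power_mono) auto
    also have "\<dots> = 12 * R\<^sup>2 / r ^ 3 * ?c\<^sup>2 * e" by (simp add: power_mult_distrib)
    also have "?c\<^sup>2 = (real k + 1) powr (2 / 3)" by (simp add: powr_power)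
    finally show ?thesis .
  qed
qed

text \<open>The errors at \<open>k\<close> and \<open>Suc k\<close> add up. Since (k + 2)^(2/3) <= 2
  (k + 1)^(2/3), the second is at most twice the bound for the first, whence 36 = 12 + 24.\<close>

lemma density_function_diff_le:
  assumes A: "periodic_packing v A r" and Q: "periodic_packing w Q r"
    and R: "0 < R" "\<And>x. A \<inter> cball x R \<noteq> {}" "\<And>x. Q \<inter> cball x R \<noteq> {}"
    and \<gamma>: "bij_betw \<gamma> A Q" "\<And>a. a \<in> A \<Longrightarrow> norm (a - \<gamma> a) \<le> e"
    and t: "0 \<le> t" and e: "0 \<le> e"
  shows "\<bar>density_function v A k t - density_function w Q k t\<bar> \<le> 36 * R\<^sup>2 / r ^ 3 * (real k + 1) powr (2 / 3) * e"
proof -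
  have inv: "bij_betw (inv_into A \<gamma>) Q A" using \<gamma>(1) by (rule bij_betw_inv_into)
  have inv_le: "norm (q - inv_into A \<gamma> q) \<le> e" if "q \<in> Q" for q
    using \<gamma>(2)[of "inv_into A \<gamma> q"] bij_betw_apply[OF inv that] bij_betw_inv_into_right[OF \<gamma>(1) that]
    by (simp add: norm_minus_commute)
  let ?K = "12 * R\<^sup>2 / r ^ 3"
  have K: "0 \<le> ?K" using periodic_packing.r_pos[OF A] by simp
  have diff: "\<bar>cover_fraction v A j t - cover_fraction w Q j t\<bar> \<le> ?K * (real j + 1) powr (2 / 3) * e" for j
    using cover_fraction_diff_le[OF A Q R(1,2,3) \<gamma> t e, of j]
      cover_fraction_diff_le[OF Q A R(1,3,2) inv inv_le t e, of j] by linarith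
  have add: "\<bar>a - b\<bar> \<le> x \<Longrightarrow> \<bar>a' - b'\<bar> \<le> y \<Longrightarrow> y \<le> z \<Longrightarrow>
      \<bar>a - a' - (b - b')\<bar> \<le> x + z" for a a' b b' x y z :: real
    by linarith
  have "(real (Suc k) + 1) powr (2 / 3) \<le> (2 * (real k + 1)) powr (2 / 3)"
    by (intro powr_mono2) auto
  also have "\<dots> = 2 powr (2 / 3) * (real k + 1) powr (2 / 3)" by (rule powr_mult)
  also have "\<dots> \<le> 2 * (real k + 1) powr (2 / 3)"
    using powr_mono[of "2 / 3" 1 "2::real"] by (intro mult_right_mono) auto
  finally have "?K * (real (Suc k) + 1) powr (2 / 3) * e \<le> ?K * (2 * (real k + 1) powr (2 / 3)) * e"
    using K e by (intro mult_right_mono mult_left_mono)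
  then have "\<bar>density_function v A k t - density_function w Q k t\<bar>
      \<le> ?K * (real k + 1) powr (2 / 3) * e + ?K * (2 * (real k + 1) powr (2 / 3)) * e"
    using add[OF diff[of k] diff[of "Suc k"]] unfolding density_function_def by blast
  also have "\<dots> = 36 * R\<^sup>2 / r ^ 3 * (real k + 1) powr (2 / 3) * e" by (simp add: algebra_simps)
  finally show ?thesis .
qed

section \<open>Passage to the fingerprint and bottleneck distances\<close>

lemma fingerprint_dist_le:
  assumes "\<And>k t. 0 \<le> t \<Longrightarrow> \<bar>\<Psi> k t - \<Phi> k t\<bar> \<le> (real k + 1) powr (2 / 3) * c"
  shows "fingerprint_dist \<Psi> \<Phi> \<le> ereal c"
  unfolding fingerprint_dist_def
proof (rule SUP_least)
  fix k
  have "(SUP t\<in>{0..}. ereal \<bar>\<Psi> k t - \<Phi> k t\<bar>) \<le> ereal ((real k + 1) powr (2 / 3) * c)"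
    using assms by (intro SUP_least) simp
  then have "ereal ((real k + 1) powr (- 2 / 3)) * (SUP t\<in>{0..}. ereal \<bar>\<Psi> k t - \<Phi> k t\<bar>)
      \<le> ereal ((real k + 1) powr (- 2 / 3)) * ereal ((real k + 1) powr (2 / 3) * c)"
    by (intro ereal_mult_left_mono) auto
  also have "\<dots> = ereal c" by (simp add: mult.assoc[symmetric] powr_add[symmetric])
  finally show "ereal ((real k + 1) powr (- 2 / 3)) * (SUP t\<in>{0..}. ereal \<bar>\<Psi> k t - \<Phi> k t\<bar>) \<le> ereal c" .
qed

text \<open>A point of \<open>A\<close> keeps each supremum nonnegative; over the empty set it would
  be minus infinity in \<open>ereal\<close>. If no bijection exists, the infimum is plus
  infinity.\<close>

lemma bottleneck_dist_nonneg:
  assumes "A \<noteq> {}"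
  shows "0 \<le> bottleneck_dist A Q"
  unfolding bottleneck_dist_def
proof (rule INF_greatest)
  fix \<gamma> :: "R3 \<Rightarrow> R3"
  obtain a where "a \<in> A" using assms by blast
  then show "0 \<le> (SUP a\<in>A. ereal (norm (a - \<gamma> a)))" by (intro SUP_upper2[of a]) auto
qed

text \<open>The infimum need not be attained, so a bijection is extracted only for bounds strictly
  above the distance.\<close>

lemma bottleneck_dist_less_bijection:
  assumes "bottleneck_dist A Q < ereal e"
  obtains \<gamma> where "bij_betw \<gamma> A Q" "\<And>a. a \<in> A \<Longrightarrow> norm (a - \<gamma> a) \<le> e"
proof -
  obtain \<gamma> where \<gamma>: "bij_betw \<gamma> A Q" "(SUP a\<in>A. ereal (norm (a - \<gamma> a))) < ereal e"
    using assms unfolding bottleneck_dist_def by (auto simp: INF_less_iff)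
  show thesis
  proof (rule that[OF \<gamma>(1)])
    fix a assume "a \<in> A"
    then have "ereal (norm (a - \<gamma> a)) \<le> (SUP a\<in>A. ereal (norm (a - \<gamma> a)))" by (rule SUP_upper)
    also note \<gamma>(2)
    finally show "norm (a - \<gamma> a) \<le> e" by simp
  qed
qed

theorem theorem4p2:
  fixes r R :: real
  assumes "0 < r"
  shows "\<exists>C::real. \<forall>A Q v w.
           periodic_with_basis v A \<and> periodic_with_basis w Q \<and>
           r \<le> packing_radius A \<and> r \<le> packing_radius Q \<and>
           covering_radius A \<le> R \<and> covering_radius Q \<le> R \<and>
           bottleneck_dist A Q < ereal r \<longrightarrow>
           fingerprint_dist (density_function v A) (density_function w Q)
             \<le> ereal C * bottleneck_dist A Q"
proof -
  \<comment> \<open>\<open>R\<close> may be nonpositive as given; enlarging it preserves the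
    covering property and makes the radius positive.\<close>
  define R' where "R' = max R 1"
  define C where "C = 36 * R'\<^sup>2 / r ^ 3"
  have "0 < R'" by (simp add: R'_def)
  have "0 < C" using assms \<open>0 < R'\<close> by (simp add: C_def)
  show ?thesis
  proof (intro exI[of _ C] allI impI, elim conjE)
    fix A Q v w
    assume A: "periodic_with_basis v A" "r \<le> packing_radius A" "covering_radius A \<le> R"
      and Q: "periodic_with_basis w Q" "r \<le> packing_radius Q" "covering_radius Q \<le> R"
      and less: "bottleneck_dist A Q < ereal r"
    have pA: "periodic_packing v A r" and pQ: "periodic_packing w Q r"
      using A Q assms by unfold_locales
    have cover: "S \<inter> cball x R' \<noteq> {}" if "periodic_with_basis u S" "covering_radius S \<le> R" for u S x
    proof -
      have "cball x (covering_radius S) \<subseteq> cball x R'" using that(2) by (auto simp: R'_def)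
      then show ?thesis using covering_radius_least(1)[OF that(1)] by blast
    qed
    have "0 \<le> bottleneck_dist A Q"
      using periodic_set_two_points[OF A(1)] by (intro bottleneck_dist_nonneg) blast
    \<comment> \<open>Being below \<open>r\<close>, the distance is finite and can be handled as a
      real number.\<close>
    then obtain \<delta> where \<delta>: "bottleneck_dist A Q = ereal \<delta>" "0 \<le> \<delta>"
      using less by (cases "bottleneck_dist A Q") auto
    have le: "fingerprint_dist (density_function v A) (density_function w Q) \<le> ereal (C * e)" if "\<delta> < e" for e
    proof -
      obtain \<gamma> where \<gamma>: "bij_betw \<gamma> A Q" "\<And>a. a \<in> A \<Longrightarrow> norm (a - \<gamma> a) \<le> e"
        using bottleneck_dist_less_bijection[of A Q e] \<delta>(1) \<open>\<delta> < e\<close> by (metis less_ereal.simps(1))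
      have e: "0 \<le> e" using \<delta>(2) that by simp
      show ?thesis
        using density_function_diff_le[OF pA pQ \<open>0 < R'\<close> cover[OF A(1,3)] cover[OF Q(1,3)] \<gamma> _ e]
        by (intro fingerprint_dist_le) (simp add: C_def algebra_simps)
    qed
    have "fingerprint_dist (density_function v A) (density_function w Q) \<le> ereal (C * \<delta>)"
    proof (rule ereal_le_epsilon2)
      fix \<epsilon> :: real assume "0 < \<epsilon>"
      then show "fingerprint_dist (density_function v A) (density_function w Q) \<le> ereal (C * \<delta>) + ereal \<epsilon>"
        \<comment> \<open>Chosen so that \<open>C * e\<close> equals
          \<open>C * \<delta> + \<epsilon>\<close>; the limit replaces an optimal bijection.\<close>
        using le[of "\<delta> + \<epsilon> / C"] \<open>0 < C\<close> by (simp add: distrib_left)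
    qed
    then show "fingerprint_dist (density_function v A) (density_function w Q) \<le> ereal C * bottleneck_dist A Q"
      by (simp add: \<delta>(1))
  qed
qed

end
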